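(* Let $a>0$, $\tfrac12<\alpha<1$. Let $u_0:\mathbb{R}\to\mathbb{R}$ be a non-random, non-negative, bounded function for which there is a constant $c>0$ with $u_0(x)>c$ for all $x\in\mathbb{R}$. Let $\sigma:\mathbb{R}\to\mathbb{R}$ satisfy $\sigma(0)=0$, and suppose there are finite positive constants $L_\sigma,\mathrm{Lip}_\sigma$ such that $|\sigma(x)-\sigma(y)|\le \mathrm{Lip}_\sigma|x-y|$ and $|\sigma(x)|\ge L_\sigma|x|$ for all $x,y\in\mathbb{R}$. For $\lambda>0$ let $u$ be an $L^2$-continuous solution of $$T^a_{\alpha,t}u(x,t)=\lambda\,\sigma(u(x,t))\,\dot W_t,\qquad x\in\mathbb{R},\ t>a,$$ with initial condition $u_0$. Then for all $x\in\mathbb{R}$ and $\lambda>0$, $$\frac{(\lambda L_\sigma)^2}{2\alpha-1}\le\liminf_{t\to\infty}\frac{\log\mathbb{E}|u(x,t)|^2}{(t-a)^{2\alpha-1}}\le\limsup_{t\to\infty}\frac{\log\mathbb{E}|u(x,t)|^2}{(t-a)^{2\alpha-1}}\le\frac{(\lambda\,\mathrm{Lip}_\sigma)^2}{2\alpha-1}.$$ When $\mathrm{Lip}_\sigma=L_\sigma=L$, $$\lim_{t\to\infty}\frac{\log\mathbb{E}|u(x,t)|^2}{(t-a)^{2\alpha-1}}=\frac{(\lambda L)^2}{2\alpha-1}.$$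
   Context: $(W_t)_{t\ge 0}$ is a standard one-dimensional Wiener process with its filtration and $\dot W_t$ its generalized derivative; $T^a_{\alpha,t}v(x,t)=\lim_{\epsilon\to0}\frac{v(x,t+\epsilon(t-a)^{1-\alpha})-v(x,t)}{\epsilon}$ is the conformable time-fractional derivative of order $\alpha$ starting from $a$. A solution of the equation is understood in the mild sense: a random field $u=(u(x,t))_{x\in\mathbb{R},t\ge a}$ such that for each $x$ the process $t\mapsto u(x,t)$ is predictable, $\int_a^t(s-a)^{2(\alpha-1)}\mathbb{E}|\sigma(u(x,s))|^2\,ds<\infty$ for all $t\geq a$, and, almost surely for each $x\in\mathbb{R}$ and $t\ge a$, $$u(x,t)=u_0(x)+\lambda\int_a^t(s-a)^{\alpha-1}\sigma(u(x,s))\,dW_s\quad\text{(It\^o integral)}.$$ $u$ is $L^2$-continuous if $\mathbb{E}|u(x,t)|^2<\infty$ for all $(x,t)$ and $(x,t)\mapsto u(x,t)\in L^2(\mathbb{P})$ is continuous. *)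

theory Defs
  imports "HOL-Probability.Probability"
begin

text \<open>
  A standard one-dimensional Wiener process together with its filtration. The filtration may be
  the one generated by \<open>W\<close>, its augmentation by null sets, or any larger one with respect to which
  the increments of \<open>W\<close> stay independent of the past. Time is \<open>[0,\<infinity>)\<close>: the members of \<open>F\<close> with
  negative index (present only because the index type is \<open>real\<close>) and the values of \<open>W\<close> at negative
  times are never used; a filtration on \<open>[0,\<infinity>)\<close> can be extended by \<open>F t = F 0\<close> for \<open>t < 0\<close>.
\<close>

locale wiener_process = prob_space M + filtration "space M" F
  for M :: "'a measure" and F :: "real \<Rightarrow> 'a measure" +
  fixes W :: "real \<Rightarrow> 'a \<Rightarrow> real"
  assumes subalgebra_F: "\<And>t. subalgebra M (F t)"
    and adapted: "\<And>t. 0 \<le> t \<Longrightarrow> W t \<in> borel_measurable (F t)"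
    and start: "AE \<omega> in M. W 0 \<omega> = 0"
    and normal_increments: "\<And>s t. 0 \<le> s \<Longrightarrow> s < t \<Longrightarrow>
      distributed M lborel (\<lambda>\<omega>. W t \<omega> - W s \<omega>) (normal_density 0 (sqrt (t - s)))"
    and indep_increments: "\<And>s t. 0 \<le> s \<Longrightarrow> s < t \<Longrightarrow>
      indep_set (sets (F s)) (sets (vimage_algebra (space M) (\<lambda>\<omega>. W t \<omega> - W s \<omega>) borel))"
    and continuous_paths: "AE \<omega> in M. continuous_on {0..} (\<lambda>t. W t \<omega>)"

text \<open>The predictable \<open>\<sigma>\<close>-algebra on \<open>[a,\<infinity>) \<times> \<Omega>\<close>.\<close>

definition predictable_algebra :: "'a measure \<Rightarrow> (real \<Rightarrow> 'a measure) \<Rightarrow> real \<Rightarrow> (real \<times> 'a) measure"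
  where "predictable_algebra M F a = sigma ({a..} \<times> space M)
    ({{a} \<times> A |A. A \<in> sets (F a)} \<union>
     {{s<..t} \<times> A |s t A. a \<le> s \<and> s < t \<and> A \<in> sets (F s)})"

definition predictable :: "'a measure \<Rightarrow> (real \<Rightarrow> 'a measure) \<Rightarrow> real \<Rightarrow> (real \<Rightarrow> 'a \<Rightarrow> real) \<Rightarrow> bool"
  where "predictable M F a X \<longleftrightarrow>
    (\<lambda>(s, \<omega>). X s \<omega>) \<in> borel_measurable (predictable_algebra M F a)"

text \<open>
  A simple process on \<open>(a,t]\<close> is given by a partition \<open>a = \<tau> 0 \<le> \<dots> \<le> \<tau> n = t\<close> and bounded
  \<open>F (\<tau> i)\<close>-measurable random variables \<open>\<xi> i\<close>, \<open>i < n\<close>, its value on \<open>(\<tau> i, \<tau> (i + 1)]\<close>.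
\<close>

definition simple_process ::
  "'a measure \<Rightarrow> (real \<Rightarrow> 'a measure) \<Rightarrow> real \<Rightarrow> real \<Rightarrow> nat \<Rightarrow> (nat \<Rightarrow> real) \<Rightarrow> (nat \<Rightarrow> 'a \<Rightarrow> real) \<Rightarrow> bool"
  where "simple_process M F a t n \<tau> \<xi> \<longleftrightarrow>
    \<tau> 0 = a \<and> \<tau> n = t \<and> (\<forall>i<n. \<tau> i \<le> \<tau> (Suc i)) \<and>
    (\<forall>i<n. \<xi> i \<in> borel_measurable (F (\<tau> i))) \<and>
    (\<exists>K. \<forall>i<n. \<forall>\<omega>\<in>space M. \<bar>\<xi> i \<omega>\<bar> \<le> K)"

definition simple_value ::
  "nat \<Rightarrow> (nat \<Rightarrow> real) \<Rightarrow> (nat \<Rightarrow> 'a \<Rightarrow> real) \<Rightarrow> real \<Rightarrow> 'a \<Rightarrow> real"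
  where "simple_value n \<tau> \<xi> s \<omega> = (\<Sum>i<n. \<xi> i \<omega> * indicator {\<tau> i<..\<tau> (Suc i)} s)"

definition simple_integral ::
  "(real \<Rightarrow> 'a \<Rightarrow> real) \<Rightarrow> nat \<Rightarrow> (nat \<Rightarrow> real) \<Rightarrow> (nat \<Rightarrow> 'a \<Rightarrow> real) \<Rightarrow> 'a \<Rightarrow> real"
  where "simple_integral W n \<tau> \<xi> \<omega> = (\<Sum>i<n. \<xi> i \<omega> * (W (\<tau> (Suc i)) \<omega> - W (\<tau> i) \<omega>))"

text \<open>
  \<open>I\<close> is a version of the Ito integral of the predictable process \<open>f\<close> with respect to \<open>W\<close> over
  \<open>[a,t]\<close>: it is the limit in \<open>L\<^sup>2\<close> of the integrals of simple processes that converge to \<open>f\<close> in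
  \<open>L\<^sup>2([a,t] \<times> \<Omega>)\<close>. Versions differ on a null set only, so this is a relation.
\<close>

definition has_ito_integral ::
  "'a measure \<Rightarrow> (real \<Rightarrow> 'a measure) \<Rightarrow> (real \<Rightarrow> 'a \<Rightarrow> real) \<Rightarrow> real \<Rightarrow> real \<Rightarrow>
    (real \<Rightarrow> 'a \<Rightarrow> real) \<Rightarrow> ('a \<Rightarrow> real) \<Rightarrow> bool"
  where "has_ito_integral M F W a t f I \<longleftrightarrow>
    predictable M F a f \<and> I \<in> borel_measurable M \<and>
    (\<exists>n \<tau> \<xi>. (\<forall>k. simple_process M F a t (n k) (\<tau> k) (\<xi> k)) \<and>
      (\<lambda>k. \<integral>\<^sup>+s\<in>{a..t}. (\<integral>\<^sup>+\<omega>. ennreal ((f s \<omega> - simple_value (n k) (\<tau> k) (\<xi> k) s \<omega>)\<^sup>2) \<partial>M) \<partial>lborel)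
        \<longlonglongrightarrow> 0 \<and>
      (\<lambda>k. \<integral>\<^sup>+\<omega>. ennreal ((I \<omega> - simple_integral W (n k) (\<tau> k) (\<xi> k) \<omega>)\<^sup>2) \<partial>M) \<longlonglongrightarrow> 0)"

text \<open>
  Mild solutions on \<open>t \<ge> a\<close> of the equation \<open>T u(x,t) = lam * \<sigma>(u(x,t)) dW\<^sub>t/dt\<close> with initial
  condition \<open>u0\<close>, where \<open>T v(t) = lim\<^bsub>\<epsilon>\<rightarrow>0\<^esub> (v(t + \<epsilon> (t-a)\<^bsup>1-\<alpha>\<^esup>) - v(t)) / \<epsilon>\<close> is the conformable
  derivative of order \<open>\<alpha>\<close> starting from \<open>a\<close>. The weight \<open>(s-a)\<^bsup>\<alpha>-1\<^esup>\<close> comes from inverting \<open>T\<close>, since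
  \<open>T v(t) = (t-a)\<^bsup>1-\<alpha>\<^esup> v'(t)\<close> for differentiable \<open>v\<close>; at \<open>s = a\<close> the term \<open>0 powr (\<alpha> - 1)\<close> is \<open>0\<close>,
  which is immaterial. The argument order is \<open>u x t \<omega>\<close>. The exceptional null set may depend on \<open>x\<close> and \<open>t\<close>. The integrability condition uses
  the nonnegative integral, so that an infinite second moment is not silently read as \<open>0\<close>.
\<close>

definition mild_solution ::
  "'a measure \<Rightarrow> (real \<Rightarrow> 'a measure) \<Rightarrow> (real \<Rightarrow> 'a \<Rightarrow> real) \<Rightarrow> real \<Rightarrow> real \<Rightarrow> real \<Rightarrow>
    (real \<Rightarrow> real) \<Rightarrow> (real \<Rightarrow> real) \<Rightarrow> (real \<Rightarrow> real \<Rightarrow> 'a \<Rightarrow> real) \<Rightarrow> bool"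
  where "mild_solution M F W a \<alpha> lam \<sigma> u0 u \<longleftrightarrow>
    (\<forall>x. predictable M F a (u x)) \<and>
    (\<forall>x. \<forall>t\<ge>a. (\<integral>\<^sup>+s\<in>{a..t}. ennreal ((s - a) powr (2 * (\<alpha> - 1))) *
                    (\<integral>\<^sup>+\<omega>. ennreal (\<bar>\<sigma> (u x s \<omega>)\<bar>\<^sup>2) \<partial>M) \<partial>lborel) < \<infinity>) \<and>
    (\<forall>x. \<forall>t\<ge>a. \<exists>I.
        has_ito_integral M F W a t (\<lambda>s \<omega>. (s - a) powr (\<alpha> - 1) * \<sigma> (u x s \<omega>)) I \<and>
        (AE \<omega> in M. u x t \<omega> = u0 x + lam * I \<omega>))"

text \<open>
  Square integrability and continuity of \<open>(x,t) \<mapsto> u(x,t)\<close>, from \<open>\<real> \<times> [a,\<infinity>)\<close> to \<open>L\<^sup>2(M)\<close>.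
\<close>

definition L2_continuous :: "'a measure \<Rightarrow> real \<Rightarrow> (real \<Rightarrow> real \<Rightarrow> 'a \<Rightarrow> real) \<Rightarrow> bool"
  where "L2_continuous M a u \<longleftrightarrow>
    (\<forall>x. \<forall>t\<ge>a. u x t \<in> borel_measurable M \<and> integrable M (\<lambda>\<omega>. \<bar>u x t \<omega>\<bar>\<^sup>2)) \<and>
    (\<forall>x. \<forall>t\<ge>a. ((\<lambda>(y, s). \<integral>\<omega>. \<bar>u y s \<omega> - u x t \<omega>\<bar>\<^sup>2 \<partial>M) \<longlongrightarrow> 0)
                  (at (x, t) within UNIV \<times> {a..}))"

end

theory Submission
  imports Defs
begin

text \<open>
  The variable \<open>x\<close> is a parameter of the equation; fix it and put \<open>m t = E (u(x,t)\<^sup>2)\<close> and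
  \<open>g t = E (\<sigma>(u(x,t))\<^sup>2)\<close>. An Ito integral has mean zero, and its second moment is given by the Ito
  isometry; squaring the mild equation therefore leaves the deterministic identity
  \<open>m t = u0(x)\<^sup>2 + lam\<^sup>2 * \<integral>\<^bsub>a\<^esub>\<^bsup>t\<^esup> (s-a)\<^bsup>2(\<alpha>-1)\<^esup> g s ds\<close> (lemma \<open>second_moment_mild_solution\<close>).
  The hypotheses on \<open>\<sigma>\<close> give \<open>L\<^sub>\<sigma>\<^sup>2 m \<le> g \<le> Lip\<^sub>\<sigma>\<^sup>2 m\<close>.

  Since \<open>u\<close> is \<open>L\<^sup>2\<close>-continuous and \<open>\<sigma>\<close> is Lipschitz, \<open>m\<close> and \<open>g\<close> are continuous on \<open>[a,\<infinity>)\<close>. The identity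
  may thus be differentiated for \<open>t > a\<close>, and \<open>m'\<close> lies between the multiples \<open>(lam L\<^sub>\<sigma>)\<^sup>2\<close> and
  \<open>(lam Lip\<^sub>\<sigma>)\<^sup>2\<close> of \<open>(t-a)\<^bsup>2(\<alpha>-1)\<^esup> m t\<close>. The weight has the primitive \<open>(t-a)\<^bsup>2\<alpha>-1\<^esup> / (2\<alpha>-1)\<close>, because
  \<open>\<alpha> > 1/2\<close>, so a Gronwall argument (lemma \<open>exponential_minorant\<close>, applied to \<open>m\<close> and to \<open>-m\<close>)
  encloses \<open>m t\<close> between \<open>u0(x)\<^sup>2 exp (C (t-a)\<^bsup>2\<alpha>-1\<^esup> / (2\<alpha>-1))\<close> for these two constants \<open>C\<close>. As
  \<open>u0(x) > 0\<close>, taking logarithms and dividing by \<open>(t-a)\<^bsup>2\<alpha>-1\<^esup>\<close> gives the bounds on the lower and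
  upper limit and, when the constants agree, the limit.

  The Ito isometry is proved from the definition of the integral: for simple processes it follows
  from the independence of the increments of \<open>W\<close> from the past, and it passes to \<open>L\<^sup>2\<close> limits because
  \<open>L\<^sup>2\<close> convergence implies convergence of second moments.
\<close>

section \<open>Second moments under \<open>L\<^sup>2\<close> convergence\<close>

lemma square_sum_bound: "(x::real)\<^sup>2 \<le> 2 * y\<^sup>2 + 2 * (x - y)\<^sup>2"
proof -
  have "2 * y\<^sup>2 + 2 * (x - y)\<^sup>2 - x\<^sup>2 = (x - 2 * y)\<^sup>2"
    by (simp add: power2_eq_square algebra_simps)
  then show ?thesis by (metis diff_ge_0_iff_ge zero_le_power2)
qed

lemma integrable_square_diff:
  fixes X Y :: "'a \<Rightarrow> real"
  assumes [measurable]: "X \<in> borel_measurable N" "Y \<in> borel_measurable N"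
    and "integrable N (\<lambda>\<omega>. (X \<omega>)\<^sup>2)" "integrable N (\<lambda>\<omega>. (Y \<omega>)\<^sup>2)"
  shows "integrable N (\<lambda>\<omega>. (X \<omega> - Y \<omega>)\<^sup>2)"
proof (rule Bochner_Integration.integrable_bound)
  show "integrable N (\<lambda>\<omega>. 2 * (X \<omega>)\<^sup>2 + 2 * (Y \<omega>)\<^sup>2)" using assms by simp
  show "AE \<omega> in N. norm ((X \<omega> - Y \<omega>)\<^sup>2) \<le> norm (2 * (X \<omega>)\<^sup>2 + 2 * (Y \<omega>)\<^sup>2)"
    using square_sum_bound[of "X \<omega> - Y \<omega>" "X \<omega>" for \<omega>] by (intro AE_I2) (simp add: abs_of_nonneg)
qed simp

text \<open>
  Young's inequality for the cross term of \<open>x\<^sup>2 = (y + (x - y))\<^sup>2\<close>. After integration it replaces the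
  Cauchy-Schwarz inequality: a small \<open>d\<close> is chosen first, and then \<open>(x - y)\<^sup>2\<close> is made small.
\<close>

lemma square_diff_bound:
  fixes x y d :: real assumes "d > 0"
  shows "\<bar>x\<^sup>2 - y\<^sup>2\<bar> \<le> (1 + 1 / d) * (x - y)\<^sup>2 + d * y\<^sup>2"
proof -
  have "0 \<le> (sqrt d * \<bar>y\<bar> - \<bar>x - y\<bar> / sqrt d)\<^sup>2" by simp
  also have "\<dots> = d * y\<^sup>2 - 2 * (\<bar>y\<bar> * \<bar>x - y\<bar>) + (x - y)\<^sup>2 / d"
    using assms by (simp add: power2_diff power_mult_distrib power_divide)
  finally have "2 * (\<bar>y\<bar> * \<bar>x - y\<bar>) \<le> d * y\<^sup>2 + (x - y)\<^sup>2 / d" by simp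
  moreover have "x\<^sup>2 - y\<^sup>2 = (x - y)\<^sup>2 + 2 * (y * (x - y))"
    by (simp add: power2_eq_square algebra_simps)
  then have "\<bar>x\<^sup>2 - y\<^sup>2\<bar> \<le> (x - y)\<^sup>2 + 2 * (\<bar>y\<bar> * \<bar>x - y\<bar>)"
    using abs_triangle_ineq[of "(x - y)\<^sup>2" "2 * (y * (x - y))"] by (simp add: abs_mult)
  ultimately show ?thesis by (simp add: algebra_simps)
qed

lemma L2_norm_tendsto:
  fixes X :: "'i \<Rightarrow> 'a \<Rightarrow> real"
  assumes Y[measurable]: "Y \<in> borel_measurable N" and Y2: "integrable N (\<lambda>\<omega>. (Y \<omega>)\<^sup>2)"
    and X: "\<forall>\<^sub>F i in G. X i \<in> borel_measurable N \<and> integrable N (\<lambda>\<omega>. (X i \<omega>)\<^sup>2)"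
    and D: "((\<lambda>i. \<integral>\<omega>. (X i \<omega> - Y \<omega>)\<^sup>2 \<partial>N) \<longlongrightarrow> 0) G"
  shows "((\<lambda>i. \<integral>\<omega>. (X i \<omega>)\<^sup>2 \<partial>N) \<longlongrightarrow> (\<integral>\<omega>. (Y \<omega>)\<^sup>2 \<partial>N)) G"
proof (rule tendstoI)
  fix e :: real assume e: "e > 0"
  define B where "B = (\<integral>\<omega>. (Y \<omega>)\<^sup>2 \<partial>N)"
  \<comment> \<open>Chosen so that the part \<open>d * B\<close> of the error stays below \<open>e / 2\<close>, also when \<open>B = 0\<close>.\<close>
  define d where "d = e / (2 * (1 + B))"
  have B: "B \<ge> 0" unfolding B_def by simp
  then have d: "d > 0" unfolding d_def using e by simp
  have dB: "d * B < e / 2"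
    unfolding d_def using e B by (simp add: field_simps)
  have "((\<lambda>i. (1 + 1 / d) * (\<integral>\<omega>. (X i \<omega> - Y \<omega>)\<^sup>2 \<partial>N)) \<longlongrightarrow> 0) G"
    using tendsto_mult_left[OF D, of "1 + 1 / d"] by simp
  then have "\<forall>\<^sub>F i in G. (1 + 1 / d) * (\<integral>\<omega>. (X i \<omega> - Y \<omega>)\<^sup>2 \<partial>N) < e / 2"
    using e by (intro order_tendstoD) auto
  with X show "\<forall>\<^sub>F i in G. dist (\<integral>\<omega>. (X i \<omega>)\<^sup>2 \<partial>N) (\<integral>\<omega>. (Y \<omega>)\<^sup>2 \<partial>N) < e"
  proof eventually_elim
    case (elim i)
    then have [measurable]: "X i \<in> borel_measurable N" and X2: "integrable N (\<lambda>\<omega>. (X i \<omega>)\<^sup>2)"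
      by auto
    have D2: "integrable N (\<lambda>\<omega>. (X i \<omega> - Y \<omega>)\<^sup>2)"
      using X2 Y2 by (intro integrable_square_diff) auto
    have "\<bar>(\<integral>\<omega>. (X i \<omega>)\<^sup>2 \<partial>N) - B\<bar> = \<bar>\<integral>\<omega>. (X i \<omega>)\<^sup>2 - (Y \<omega>)\<^sup>2 \<partial>N\<bar>"
      unfolding B_def using X2 Y2 by simp
    also have "\<dots> \<le> (\<integral>\<omega>. \<bar>(X i \<omega>)\<^sup>2 - (Y \<omega>)\<^sup>2\<bar> \<partial>N)" by (rule integral_abs_bound)
    also have "\<dots> \<le> (\<integral>\<omega>. (1 + 1 / d) * (X i \<omega> - Y \<omega>)\<^sup>2 + d * (Y \<omega>)\<^sup>2 \<partial>N)"
      using X2 Y2 D2 square_diff_bound[OF d] by (intro integral_mono) auto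
    also have "\<dots> = (1 + 1 / d) * (\<integral>\<omega>. (X i \<omega> - Y \<omega>)\<^sup>2 \<partial>N) + d * B"
      unfolding B_def using D2 Y2 by simp
    also have "\<dots> < e" using elim(2) dB by linarith
    finally show ?case unfolding B_def dist_real_def .
  qed
qed

text \<open>
  The form in which the Ito integral is defined: distances are nonnegative integrals, and the square
  integrability of the limit is a conclusion, since it lies at finite distance from some \<open>X k\<close>.
\<close>

lemma L2_limit_nn_integral:
  fixes X :: "nat \<Rightarrow> 'a \<Rightarrow> real"
  assumes [measurable]: "Y \<in> borel_measurable N" "\<And>k. X k \<in> borel_measurable N"
    and fin: "\<And>k. (\<integral>\<^sup>+\<omega>. ennreal ((X k \<omega>)\<^sup>2) \<partial>N) < \<infinity>"
    and D: "(\<lambda>k. \<integral>\<^sup>+\<omega>. ennreal ((Y \<omega> - X k \<omega>)\<^sup>2) \<partial>N) \<longlonglongrightarrow> 0"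
  shows "(\<integral>\<^sup>+\<omega>. ennreal ((Y \<omega>)\<^sup>2) \<partial>N) < \<infinity>"
    and "(\<lambda>k. \<integral>\<^sup>+\<omega>. ennreal ((X k \<omega>)\<^sup>2) \<partial>N) \<longlonglongrightarrow> (\<integral>\<^sup>+\<omega>. ennreal ((Y \<omega>)\<^sup>2) \<partial>N)"
proof -
  have X2: "integrable N (\<lambda>\<omega>. (X k \<omega>)\<^sup>2)" for k
    using fin[of k] by (intro integrableI_nonneg) auto
  have ev: "\<forall>\<^sub>F k in sequentially. (\<integral>\<^sup>+\<omega>. ennreal ((Y \<omega> - X k \<omega>)\<^sup>2) \<partial>N) < 1"
    using D by (rule order_tendstoD) simp
  then obtain k where k: "(\<integral>\<^sup>+\<omega>. ennreal ((Y \<omega> - X k \<omega>)\<^sup>2) \<partial>N) < 1"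
    by (auto simp: eventually_sequentially)
  have Dk: "integrable N (\<lambda>\<omega>. (Y \<omega> - X k \<omega>)\<^sup>2)"
    using k by (intro integrableI_nonneg) (auto intro: less_trans)
  have Y2: "integrable N (\<lambda>\<omega>. (Y \<omega>)\<^sup>2)"
  proof (rule Bochner_Integration.integrable_bound)
    show "integrable N (\<lambda>\<omega>. 2 * (X k \<omega>)\<^sup>2 + 2 * (Y \<omega> - X k \<omega>)\<^sup>2)" using X2 Dk by simp
    show "AE \<omega> in N. norm ((Y \<omega>)\<^sup>2) \<le> norm (2 * (X k \<omega>)\<^sup>2 + 2 * (Y \<omega> - X k \<omega>)\<^sup>2)"
      using square_sum_bound by (intro AE_I2) (simp add: abs_of_nonneg)
  qed simp
  then show "(\<integral>\<^sup>+\<omega>. ennreal ((Y \<omega>)\<^sup>2) \<partial>N) < \<infinity>"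
    by (simp add: nn_integral_eq_integral)
  have "(\<integral>\<^sup>+\<omega>. ennreal ((Y \<omega> - X k \<omega>)\<^sup>2) \<partial>N) = ennreal (\<integral>\<omega>. (X k \<omega> - Y \<omega>)\<^sup>2 \<partial>N)" for k
    using integrable_square_diff[OF _ _ X2 Y2, of k]
    by (simp add: power2_commute[of "Y _"] nn_integral_eq_integral)
  then have "(\<lambda>k. ennreal (\<integral>\<omega>. (X k \<omega> - Y \<omega>)\<^sup>2 \<partial>N)) \<longlonglongrightarrow> ennreal 0" using D by simp
  then have "(\<lambda>k. \<integral>\<omega>. (X k \<omega> - Y \<omega>)\<^sup>2 \<partial>N) \<longlonglongrightarrow> 0"
    by (subst (asm) tendsto_ennreal_iff) auto
  then have "(\<lambda>k. \<integral>\<omega>. (X k \<omega>)\<^sup>2 \<partial>N) \<longlonglongrightarrow> (\<integral>\<omega>. (Y \<omega>)\<^sup>2 \<partial>N)"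
    using X2 Y2 by (intro L2_norm_tendsto) auto
  then show "(\<lambda>k. \<integral>\<^sup>+\<omega>. ennreal ((X k \<omega>)\<^sup>2) \<partial>N) \<longlonglongrightarrow> (\<integral>\<^sup>+\<omega>. ennreal ((Y \<omega>)\<^sup>2) \<partial>N)"
    using X2 Y2 by (simp add: nn_integral_eq_integral tendsto_ennrealI)
qed

section \<open>The Ito isometry\<close>

context wiener_process
begin

lemma past_measurable_mono:
  fixes X :: "'a \<Rightarrow> real"
  assumes "X \<in> borel_measurable (F s)" "s \<le> t"
  shows "X \<in> borel_measurable (F t)"
  using borel_measurable_subalgebra[OF sets_F_mono[OF assms(2)]] assms(1) by (simp add: space_F)

lemma past_measurable:
  fixes X :: "'a \<Rightarrow> real"
  shows "X \<in> borel_measurable (F s) \<Longrightarrow> X \<in> borel_measurable M"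
  by (rule measurable_from_subalg[OF subalgebra_F])

lemma increment_moments:
  assumes "0 \<le> s" "s \<le> t"
  shows "integrable M (\<lambda>\<omega>. W t \<omega> - W s \<omega>)"
    and "expectation (\<lambda>\<omega>. W t \<omega> - W s \<omega>) = 0"
    and "integrable M (\<lambda>\<omega>. (W t \<omega> - W s \<omega>)\<^sup>2)"
    and "expectation (\<lambda>\<omega>. (W t \<omega> - W s \<omega>)\<^sup>2) = t - s"
proof (atomize (full), cases "s = t")
  case False
  with assms have st: "s < t" and pos: "0 < sqrt (t - s)" by auto
  note D = normal_increments[OF \<open>0 \<le> s\<close> st]
  have i1: "integrable M (\<lambda>\<omega>. W t \<omega> - W s \<omega>)"
    using distributed_integrable[OF D, of "\<lambda>x. x"] integrable_normal_moment_nz_1[OF pos, of 0] by simp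
  have e1: "expectation (\<lambda>\<omega>. W t \<omega> - W s \<omega>) = 0"
    using distributed_integral[OF D, of "\<lambda>x. x"] integral_normal_moment_nz_1[OF pos, of 0] by simp
  have i2: "integrable M (\<lambda>\<omega>. (W t \<omega> - W s \<omega>)\<^sup>2)"
    using distributed_integrable[OF D, of "\<lambda>x. x\<^sup>2"] integrable_normal_moment[OF pos, of 0 2] by simp
  have e2: "expectation (\<lambda>\<omega>. (W t \<omega> - W s \<omega>)\<^sup>2) = t - s"
    using distributed_integral[OF D, of "\<lambda>x. x\<^sup>2"] integral_normal_moment_even[OF pos, of 0 1] st
    by (simp add: numeral_2_eq_2)
  show "(integrable M (\<lambda>\<omega>. W t \<omega> - W s \<omega>) \<and>
    expectation (\<lambda>\<omega>. W t \<omega> - W s \<omega>) = 0) \<and>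
    integrable M (\<lambda>\<omega>. (W t \<omega> - W s \<omega>)\<^sup>2) \<and>
    expectation (\<lambda>\<omega>. (W t \<omega> - W s \<omega>)\<^sup>2) = t - s"
    using i1 e1 i2 e2 by simp
qed simp

lemma past_indep_increment:
  fixes X :: "'a \<Rightarrow> real"
  assumes "0 \<le> s" "s < t" and X: "X \<in> borel_measurable (F s)"
  shows "indep_var borel X borel (\<lambda>\<omega>. W t \<omega> - W s \<omega>)"
  unfolding indep_var_eq
proof (intro conjI)
  show "random_variable borel X" using past_measurable[OF X] .
  show D: "random_variable borel (\<lambda>\<omega>. W t \<omega> - W s \<omega>)"
    using increment_moments(1)[of s t] assms by auto
  let ?A = "sigma_sets (space M) {X -` A \<inter> space M |A. A \<in> sets borel}"
  let ?B = "sigma_sets (space M) {(\<lambda>\<omega>. W t \<omega> - W s \<omega>) -` A \<inter> space M |A. A \<in> sets borel}"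
  have "?A \<subseteq> sets (F s)"
    using X sets.sigma_sets_subset[of "{X -` A \<inter> space M |A. A \<in> sets borel}" "F s"]
    by (auto simp: space_F measurable_def)
  moreover have "?B = sets (vimage_algebra (space M) (\<lambda>\<omega>. W t \<omega> - W s \<omega>) borel)"
    by (simp add: sets_vimage_algebra)
  ultimately show "indep_set ?A ?B"
    using indep_increments[OF assms(1,2)] unfolding indep_sets2_eq by auto
qed

text \<open>
  The case \<open>s = t\<close> is included because a simple process may repeat partition points. The increment
  is then the constant \<open>0\<close>, and the product rule holds trivially.
\<close>

lemma expectation_past_times_increment:
  fixes X :: "'a \<Rightarrow> real" and \<phi> :: "real \<Rightarrow> real"
  assumes st: "0 \<le> s" "s \<le> t" and X: "X \<in> borel_measurable (F s)" "integrable M X"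
    and \<phi>: "\<phi> \<in> borel_measurable borel" "integrable M (\<lambda>\<omega>. \<phi> (W t \<omega> - W s \<omega>))"
  shows "integrable M (\<lambda>\<omega>. X \<omega> * \<phi> (W t \<omega> - W s \<omega>))"
    and "expectation (\<lambda>\<omega>. X \<omega> * \<phi> (W t \<omega> - W s \<omega>)) =
      expectation X * expectation (\<lambda>\<omega>. \<phi> (W t \<omega> - W s \<omega>))"
proof (atomize (full), cases "s = t")
  case True
  then show "integrable M (\<lambda>\<omega>. X \<omega> * \<phi> (W t \<omega> - W s \<omega>)) \<and>
    expectation (\<lambda>\<omega>. X \<omega> * \<phi> (W t \<omega> - W s \<omega>)) =
      expectation X * expectation (\<lambda>\<omega>. \<phi> (W t \<omega> - W s \<omega>))"
    using X by (simp add: prob_space)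
next
  case False
  with st have "s < t" by simp
  from indep_var_compose[OF past_indep_increment[OF st(1) this X(1)] measurable_ident \<phi>(1)]
  have I: "indep_var borel X borel (\<lambda>\<omega>. \<phi> (W t \<omega> - W s \<omega>))" by (simp add: comp_def)
  show "integrable M (\<lambda>\<omega>. X \<omega> * \<phi> (W t \<omega> - W s \<omega>)) \<and>
    expectation (\<lambda>\<omega>. X \<omega> * \<phi> (W t \<omega> - W s \<omega>)) =
      expectation X * expectation (\<lambda>\<omega>. \<phi> (W t \<omega> - W s \<omega>))"
    using indep_var_integrable[OF I X(2) \<phi>(2)] indep_var_lebesgue_integral[OF I X(2) \<phi>(2)] by simp
qed

text \<open>
  Append one interval at a time. The integral \<open>S\<close> over the earlier intervals and the new coefficient
  are known at the left end of the new interval, so independence of the new increment \<open>D\<close> kills the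
  cross term \<open>E (S \<xi> D)\<close> and factors \<open>E (\<xi>\<^sup>2 D\<^sup>2)\<close>. Measurability of \<open>S\<close> at the last partition
  point is part of the claim because the induction needs it.
\<close>

lemma simple_integral_moments:
  fixes \<xi> :: "nat \<Rightarrow> 'a \<Rightarrow> real"
  assumes "0 \<le> \<tau> 0" "\<forall>i<n. \<tau> i \<le> \<tau> (Suc i)"
    and "\<forall>i<n. \<xi> i \<in> borel_measurable (F (\<tau> i))"
    and "\<forall>i<n. \<forall>\<omega>\<in>space M. \<bar>\<xi> i \<omega>\<bar> \<le> K"
  shows "0 \<le> \<tau> n \<and> simple_integral W n \<tau> \<xi> \<in> borel_measurable (F (\<tau> n)) \<and>
    integrable M (\<lambda>\<omega>. (simple_integral W n \<tau> \<xi> \<omega>)\<^sup>2) \<and>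
    expectation (simple_integral W n \<tau> \<xi>) = 0 \<and>
    expectation (\<lambda>\<omega>. (simple_integral W n \<tau> \<xi> \<omega>)\<^sup>2) =
      (\<Sum>i<n. expectation (\<lambda>\<omega>. (\<xi> i \<omega>)\<^sup>2) * (\<tau> (Suc i) - \<tau> i))"
  using assms
proof (induction n)
  case 0
  then show ?case by (simp add: simple_integral_def[abs_def])
next
  case (Suc n)
  define S where "S = simple_integral W n \<tau> \<xi>"
  define D where "D \<omega> = W (\<tau> (Suc n)) \<omega> - W (\<tau> n) \<omega>" for \<omega>
  have IH: "0 \<le> \<tau> n" "S \<in> borel_measurable (F (\<tau> n))" "integrable M (\<lambda>\<omega>. (S \<omega>)\<^sup>2)"
    "expectation S = 0" "expectation (\<lambda>\<omega>. (S \<omega>)\<^sup>2) =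
      (\<Sum>i<n. expectation (\<lambda>\<omega>. (\<xi> i \<omega>)\<^sup>2) * (\<tau> (Suc i) - \<tau> i))"
    using Suc unfolding S_def by auto
  have step: "\<tau> n \<le> \<tau> (Suc n)" and \<xi>: "\<xi> n \<in> borel_measurable (F (\<tau> n))"
    and K: "\<And>\<omega>. \<omega> \<in> space M \<Longrightarrow> \<bar>\<xi> n \<omega>\<bar> \<le> K"
    using Suc.prems by auto
  have S_Suc: "simple_integral W (Suc n) \<tau> \<xi> = (\<lambda>\<omega>. S \<omega> + \<xi> n \<omega> * D \<omega>)"
    unfolding S_def D_def by (simp add: simple_integral_def fun_eq_iff)
  have meas: "simple_integral W (Suc n) \<tau> \<xi> \<in> borel_measurable (F (\<tau> (Suc n)))"
    unfolding S_Suc D_def using past_measurable_mono[OF IH(2) step]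
      past_measurable_mono[OF \<xi> step] adapted[of "\<tau> (Suc n)"]
      past_measurable_mono[OF adapted step] IH(1) step
    by (intro borel_measurable_add borel_measurable_times borel_measurable_diff) auto
  note inc = increment_moments[OF IH(1) step, folded D_def]
  note past = expectation_past_times_increment[OF IH(1) step, folded D_def]
  have [measurable]: "S \<in> borel_measurable M" "\<xi> n \<in> borel_measurable M"
    by (rule past_measurable[OF IH(2)], rule past_measurable[OF \<xi>])
  have Si: "integrable M S" using IH(3) by (rule square_integrable_imp_integrable[rotated]) simp
  have \<xi>i: "integrable M (\<xi> n)"
    using K by (intro integrable_const_bound[of _ K]) auto
  have K2: "\<bar>(\<xi> n \<omega>)\<^sup>2\<bar> \<le> K\<^sup>2" if "\<omega> \<in> space M" for \<omega>
    using power_mono[OF K[OF that], of 2] by simp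
  have \<xi>2i: "integrable M (\<lambda>\<omega>. (\<xi> n \<omega>)\<^sup>2)"
    using K2 by (intro integrable_const_bound[of _ "K\<^sup>2"]) auto
  have S\<xi>i: "integrable M (\<lambda>\<omega>. S \<omega> * \<xi> n \<omega>)"
  proof (rule Bochner_Integration.integrable_bound)
    show "integrable M (\<lambda>\<omega>. K * S \<omega>)" using Si by simp
    show "AE \<omega> in M. norm (S \<omega> * \<xi> n \<omega>) \<le> norm (K * S \<omega>)"
    proof (rule AE_I2)
      fix \<omega> assume "\<omega> \<in> space M"
      then have "\<bar>\<xi> n \<omega>\<bar> \<le> \<bar>K\<bar>" using K[of \<omega>] by simp
      then show "norm (S \<omega> * \<xi> n \<omega>) \<le> norm (K * S \<omega>)"
        by (simp add: abs_mult mult.commute[of "\<bar>S \<omega>\<bar>"] mult_right_mono)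
    qed
  qed simp
  have mean: "integrable M (\<lambda>\<omega>. \<xi> n \<omega> * D \<omega>)" "expectation (\<lambda>\<omega>. \<xi> n \<omega> * D \<omega>) = 0"
    using past[OF \<xi> \<xi>i, of "\<lambda>x. x"] inc by simp_all
  have cross: "integrable M (\<lambda>\<omega>. S \<omega> * \<xi> n \<omega> * D \<omega>)"
    "expectation (\<lambda>\<omega>. S \<omega> * \<xi> n \<omega> * D \<omega>) = 0"
    using past[OF borel_measurable_times[OF IH(2) \<xi>] S\<xi>i, of "\<lambda>x. x"] inc by simp_all
  have square: "integrable M (\<lambda>\<omega>. (\<xi> n \<omega>)\<^sup>2 * (D \<omega>)\<^sup>2)"
    "expectation (\<lambda>\<omega>. (\<xi> n \<omega>)\<^sup>2 * (D \<omega>)\<^sup>2) =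
      expectation (\<lambda>\<omega>. (\<xi> n \<omega>)\<^sup>2) * (\<tau> (Suc n) - \<tau> n)"
    using past[OF borel_measurable_power[OF \<xi>] \<xi>2i, of "\<lambda>x. x\<^sup>2"] inc by simp_all
  have expand: "(S \<omega> + \<xi> n \<omega> * D \<omega>)\<^sup>2 =
      (S \<omega>)\<^sup>2 + 2 * (S \<omega> * \<xi> n \<omega> * D \<omega>) + (\<xi> n \<omega>)\<^sup>2 * (D \<omega>)\<^sup>2" for \<omega>
    by (simp add: power2_eq_square algebra_simps)
  show ?case
    using meas IH step Si mean cross square by (simp add: S_Suc expand)
qed

text \<open>
  The other side of the isometry for simple processes: the intervals \<open>(\<tau> i, \<tau> (i + 1)]\<close> are disjoint,
  so squaring a simple process squares its coefficients.
\<close>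

lemma nn_integral_simple_value_square:
  assumes "\<forall>i<n. \<tau> i \<le> \<tau> (Suc i)"
    and "\<forall>i<n. \<xi> i \<in> borel_measurable M" and "a \<le> \<tau> 0" "\<tau> n \<le> t"
    and "\<forall>i<n. integrable M (\<lambda>\<omega>. (\<xi> i \<omega>)\<^sup>2)"
  shows "(\<lambda>p. simple_value n \<tau> \<xi> (fst p) (snd p)) \<in> borel_measurable (restrict_space lborel {a..t} \<Otimes>\<^sub>M M)"
    and "(\<integral>\<^sup>+p. ennreal ((simple_value n \<tau> \<xi> (fst p) (snd p))\<^sup>2) \<partial>(restrict_space lborel {a..t} \<Otimes>\<^sub>M M)) =
      ennreal (\<Sum>i<n. expectation (\<lambda>\<omega>. (\<xi> i \<omega>)\<^sup>2) * (\<tau> (Suc i) - \<tau> i))"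
proof -
  let ?R = "restrict_space lborel {a..t}"
  have R[measurable_cong]: "sets ?R = sets (restrict_space borel {a..t})"
    by (simp add: sets_restrict_space)
  have ind[measurable]: "(\<lambda>s. indicator {\<tau> i<..\<tau> (Suc i)} s :: real) \<in> borel_measurable ?R" for i
    by (rule measurable_restrict_space1) simp
  show "(\<lambda>p. simple_value n \<tau> \<xi> (fst p) (snd p)) \<in> borel_measurable (?R \<Otimes>\<^sub>M M)"
    unfolding simple_value_def using assms(2)
    by (intro borel_measurable_sum borel_measurable_times
      measurable_compose[OF measurable_fst ind] measurable_compose[OF measurable_snd]) auto
  have meas: "(\<lambda>p. ennreal ((\<xi> i (snd p))\<^sup>2) * indicator {\<tau> i<..\<tau> (Suc i)} (fst p))
      \<in> borel_measurable (?R \<Otimes>\<^sub>M M)" if "i \<in> {..<n}" for i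
  proof -
    have [measurable]: "\<xi> i \<in> borel_measurable M" using that assms(2) by simp
    have [measurable]: "(\<lambda>s. indicator {\<tau> i<..\<tau> (Suc i)} s :: ennreal) \<in> borel_measurable ?R"
      by (rule measurable_restrict_space1) simp
    show ?thesis by measurable
  qed
  have mono: "i \<le> j \<Longrightarrow> j \<le> n \<Longrightarrow> \<tau> i \<le> \<tau> j" for i j
  proof (induction j)
    case (Suc j)
    then show ?case using assms(1) by (cases "i = Suc j") (auto intro: order_trans)
  qed simp
  \<comment> \<open>Up to \<open>\<tau> m\<close> the last indicator vanishes; beyond \<open>\<tau> m\<close> all earlier ones do.\<close>
  have sq: "(simple_value m \<tau> \<xi> s \<omega>)\<^sup>2 = (\<Sum>i<m. (\<xi> i \<omega>)\<^sup>2 * indicator {\<tau> i<..\<tau> (Suc i)} s)"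
    if "m \<le> n" for m s \<omega>
    using that
  proof (induction m)
    case (Suc m)
    have "simple_value m \<tau> \<xi> s \<omega> * indicator {\<tau> m<..\<tau> (Suc m)} s = 0"
    proof (cases "\<tau> m < s")
      case True
      then have "\<tau> (Suc i) < s" if "i < m" for i
        using mono[of "Suc i" m] that Suc.prems by simp
      then have "simple_value m \<tau> \<xi> s \<omega> = 0"
        unfolding simple_value_def by (intro sum.neutral) (force simp: indicator_def)
      then show ?thesis by simp
    qed simp
    then have "(simple_value (Suc m) \<tau> \<xi> s \<omega>)\<^sup>2 =
        (simple_value m \<tau> \<xi> s \<omega>)\<^sup>2 + (\<xi> m \<omega>)\<^sup>2 * indicator {\<tau> m<..\<tau> (Suc m)} s"
      by (auto simp: simple_value_def indicator_def)
    with Suc show ?case by simp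
  qed (simp add: simple_value_def)
  have "(\<integral>\<^sup>+p. ennreal ((simple_value n \<tau> \<xi> (fst p) (snd p))\<^sup>2) \<partial>(?R \<Otimes>\<^sub>M M)) =
      (\<integral>\<^sup>+p. (\<Sum>i<n. ennreal ((\<xi> i (snd p))\<^sup>2) * indicator {\<tau> i<..\<tau> (Suc i)} (fst p)) \<partial>(?R \<Otimes>\<^sub>M M))"
  proof (rule nn_integral_cong)
    fix p :: "real \<times> 'a"
    have "ennreal ((simple_value n \<tau> \<xi> (fst p) (snd p))\<^sup>2) =
        ennreal (\<Sum>i<n. (\<xi> i (snd p))\<^sup>2 * indicator {\<tau> i<..\<tau> (Suc i)} (fst p))"
      by (simp add: sq)
    also have "\<dots> = (\<Sum>i<n. ennreal ((\<xi> i (snd p))\<^sup>2 * indicator {\<tau> i<..\<tau> (Suc i)} (fst p)))"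
      by (rule sum_ennreal[symmetric]) simp
    also have "\<dots> = (\<Sum>i<n. ennreal ((\<xi> i (snd p))\<^sup>2) * indicator {\<tau> i<..\<tau> (Suc i)} (fst p))"
      by (simp add: ennreal_mult ennreal_indicator)
    finally show "ennreal ((simple_value n \<tau> \<xi> (fst p) (snd p))\<^sup>2) =
      (\<Sum>i<n. ennreal ((\<xi> i (snd p))\<^sup>2) * indicator {\<tau> i<..\<tau> (Suc i)} (fst p))" .
  qed
  also have "\<dots> = (\<Sum>i<n. \<integral>\<^sup>+p. ennreal ((\<xi> i (snd p))\<^sup>2) * indicator {\<tau> i<..\<tau> (Suc i)} (fst p) \<partial>(?R \<Otimes>\<^sub>M M))"
    by (intro nn_integral_sum meas)
  also have "\<dots> = (\<Sum>i<n. ennreal (expectation (\<lambda>\<omega>. (\<xi> i \<omega>)\<^sup>2) * (\<tau> (Suc i) - \<tau> i)))"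
  proof (rule sum.cong[OF refl])
    fix i assume "i \<in> {..<n}"
    then have i: "i < n" by simp
    have sub: "{\<tau> i<..\<tau> (Suc i)} \<subseteq> {a..t}" and le: "\<tau> i \<le> \<tau> (Suc i)"
      using mono[of 0 i] mono[of "Suc i" n] i assms(1,3,4) by auto
    have "(\<integral>\<^sup>+p. ennreal ((\<xi> i (snd p))\<^sup>2) * indicator {\<tau> i<..\<tau> (Suc i)} (fst p) \<partial>(?R \<Otimes>\<^sub>M M)) =
        (\<integral>\<^sup>+s. (\<integral>\<^sup>+\<omega>. ennreal ((\<xi> i \<omega>)\<^sup>2) * indicator {\<tau> i<..\<tau> (Suc i)} s \<partial>M) \<partial>?R)"
      using nn_integral_fst[OF meas[of i], symmetric] i by simp
    also have "\<dots> = (\<integral>\<^sup>+s. ennreal (expectation (\<lambda>\<omega>. (\<xi> i \<omega>)\<^sup>2)) * indicator {\<tau> i<..\<tau> (Suc i)} s \<partial>?R)"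
    proof -
      have "random_variable borel (\<xi> i)" "integrable M (\<lambda>\<omega>. (\<xi> i \<omega>)\<^sup>2)" using assms(2,5) i by auto
      then show ?thesis by (simp add: nn_integral_multc nn_integral_eq_integral)
    qed
    also have "\<dots> = (\<integral>\<^sup>+s. ennreal (expectation (\<lambda>\<omega>. (\<xi> i \<omega>)\<^sup>2)) * indicator {\<tau> i<..\<tau> (Suc i)} s \<partial>lborel)"
      using sub by (auto simp: nn_integral_restrict_space indicator_def intro!: nn_integral_cong)
    also have "\<dots> = ennreal (expectation (\<lambda>\<omega>. (\<xi> i \<omega>)\<^sup>2) * (\<tau> (Suc i) - \<tau> i))"
      using le by (simp add: nn_integral_cmult_indicator ennreal_mult)
    finally show "(\<integral>\<^sup>+p. ennreal ((\<xi> i (snd p))\<^sup>2) * indicator {\<tau> i<..\<tau> (Suc i)} (fst p) \<partial>(?R \<Otimes>\<^sub>M M)) =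
      ennreal (expectation (\<lambda>\<omega>. (\<xi> i \<omega>)\<^sup>2) * (\<tau> (Suc i) - \<tau> i))" .
  qed
  also have "\<dots> = ennreal (\<Sum>i<n. expectation (\<lambda>\<omega>. (\<xi> i \<omega>)\<^sup>2) * (\<tau> (Suc i) - \<tau> i))"
    using assms(1) by (intro sum_ennreal) auto
  finally show "(\<integral>\<^sup>+p. ennreal ((simple_value n \<tau> \<xi> (fst p) (snd p))\<^sup>2) \<partial>(?R \<Otimes>\<^sub>M M)) =
      ennreal (\<Sum>i<n. expectation (\<lambda>\<omega>. (\<xi> i \<omega>)\<^sup>2) * (\<tau> (Suc i) - \<tau> i))" .
qed

text \<open>
  Every generator of the predictable \<open>\<sigma>\<close>-algebra is a rectangle with measurable sides, so predictable
  processes are jointly measurable. This makes the iterated integral in the definition of the Ito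
  integral an integral over a product space, to which \<open>L2_limit_nn_integral\<close> applies.
\<close>

lemma predictable_measurable:
  assumes "predictable M F a f"
  shows "(\<lambda>p. f (fst p) (snd p)) \<in> borel_measurable (restrict_space lborel {a..t} \<Otimes>\<^sub>M M)"
proof -
  let ?P = "restrict_space lborel {a..t} \<Otimes>\<^sub>M M"
  have slab: "(\<lambda>p. p) -` (B \<times> A) \<inter> space ?P \<in> sets ?P"
    if B: "B \<in> sets borel" and A: "A \<in> sets (F s)" for B A s
  proof -
    have "A \<in> sets M" using subalgebra_F[of s] A by (auto simp: subalgebra_def)
    moreover from this have "A \<subseteq> space M" by (rule sets.sets_into_space)
    moreover have "B \<inter> {a..t} \<in> sets (restrict_space lborel {a..t})"
      using B by (auto simp: sets_restrict_space)
    moreover have "(\<lambda>p. p) -` (B \<times> A) \<inter> space ?P = (B \<inter> {a..t}) \<times> (A \<inter> space M)"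
      by (auto simp: space_pair_measure space_restrict_space)
    ultimately show ?thesis by (metis Int_absorb2 pair_measureI)
  qed
  have "(\<lambda>p. p) \<in> measurable ?P (predictable_algebra M F a)"
    unfolding predictable_algebra_def
  proof (rule measurable_measure_of)
    show "{{a} \<times> A |A. A \<in> sets (F a)} \<union> {{s<..t} \<times> A |s t A. a \<le> s \<and> s < t \<and> A \<in> sets (F s)}
        \<subseteq> Pow ({a..} \<times> space M)"
      using sets.sets_into_space[where M="F _"] by (fastforce simp: space_F)
    show "(\<lambda>p. p) \<in> space ?P \<rightarrow> {a..} \<times> space M"
      by (auto simp: space_pair_measure space_restrict_space)
  next
    fix y assume "y \<in> {{a} \<times> A |A. A \<in> sets (F a)} \<union>
      {{s<..t} \<times> A |s t A. a \<le> s \<and> s < t \<and> A \<in> sets (F s)}"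
    then show "(\<lambda>p. p) -` y \<inter> space ?P \<in> sets ?P"
      using slab[of "{a}"] slab[of "{_<.._}"] by auto
  qed
  then have "(\<lambda>p. case p of (s, \<omega>) \<Rightarrow> f s \<omega>) \<in> borel_measurable ?P"
    using assms unfolding predictable_def by (rule measurable_compose)
  then show ?thesis by (simp add: case_prod_beta)
qed

text \<open>
  Both sides are limits along the same simple processes: the integrals \<open>S k\<close> converge in \<open>L\<^sup>2(M)\<close>, the
  integrands \<open>V k\<close> in \<open>L\<^sup>2\<close> of the product space, and their second moments agree for each \<open>k\<close>.
\<close>

proposition ito_isometry:
  assumes "0 \<le> a" and "has_ito_integral M F W a t f I"
  shows "integrable M (\<lambda>\<omega>. (I \<omega>)\<^sup>2)" and "expectation I = 0"
    and "(\<integral>\<^sup>+s\<in>{a..t}. (\<integral>\<^sup>+\<omega>. ennreal ((f s \<omega>)\<^sup>2) \<partial>M) \<partial>lborel) = ennreal (expectation (\<lambda>\<omega>. (I \<omega>)\<^sup>2))"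
proof -
  let ?P = "restrict_space lborel {a..t} \<Otimes>\<^sub>M M"
  obtain n \<tau> \<xi> where f: "predictable M F a f" and I[measurable]: "I \<in> borel_measurable M"
    and simple: "\<And>k. simple_process M F a t (n k) (\<tau> k) (\<xi> k)"
    and V_lim: "(\<lambda>k. \<integral>\<^sup>+s\<in>{a..t}. (\<integral>\<^sup>+\<omega>. ennreal ((f s \<omega> -
        simple_value (n k) (\<tau> k) (\<xi> k) s \<omega>)\<^sup>2) \<partial>M) \<partial>lborel) \<longlonglongrightarrow> 0"
    and S_lim: "(\<lambda>k. \<integral>\<^sup>+\<omega>. ennreal ((I \<omega> - simple_integral W (n k) (\<tau> k) (\<xi> k) \<omega>)\<^sup>2) \<partial>M) \<longlonglongrightarrow> 0"
    using assms(2) unfolding has_ito_integral_def by blast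
  define S where "S k = simple_integral W (n k) (\<tau> k) (\<xi> k)" for k
  define V where "V k p = simple_value (n k) (\<tau> k) (\<xi> k) (fst p) (snd p)" for k and p :: "real \<times> 'a"
  define f' where "f' p = f (fst p) (snd p)" for p
  have f'[measurable]: "f' \<in> borel_measurable ?P"
    unfolding f'_def[abs_def] using f by (rule predictable_measurable)
  have iterated: "(\<integral>\<^sup>+s\<in>{a..t}. (\<integral>\<^sup>+\<omega>. ennreal ((g (s, \<omega>))\<^sup>2) \<partial>M) \<partial>lborel) = (\<integral>\<^sup>+p. ennreal ((g p)\<^sup>2) \<partial>?P)"
    if "g \<in> borel_measurable ?P" for g :: "real \<times> 'a \<Rightarrow> real"
    using that by (subst nn_integral_fst[symmetric]) (auto simp: nn_integral_restrict_space)
  have facts: "S k \<in> borel_measurable M \<and> integrable M (\<lambda>\<omega>. (S k \<omega>)\<^sup>2) \<and> expectation (S k) = 0 \<and>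
      V k \<in> borel_measurable ?P \<and>
      (\<integral>\<^sup>+p. ennreal ((V k p)\<^sup>2) \<partial>?P) = (\<integral>\<^sup>+\<omega>. ennreal ((S k \<omega>)\<^sup>2) \<partial>M)" for k
  proof -
    from simple[of k] obtain K where ends: "\<tau> k 0 = a" "\<tau> k (n k) = t"
      and mono: "\<forall>i<n k. \<tau> k i \<le> \<tau> k (Suc i)"
      and \<xi>: "\<forall>i<n k. \<xi> k i \<in> borel_measurable (F (\<tau> k i))"
      and K: "\<forall>i<n k. \<forall>\<omega>\<in>space M. \<bar>\<xi> k i \<omega>\<bar> \<le> K"
      unfolding simple_process_def by auto
    have \<xi>M: "\<forall>i<n k. \<xi> k i \<in> borel_measurable M"
      using \<xi> past_measurable by blast
    have \<xi>2: "\<forall>i<n k. integrable M (\<lambda>\<omega>. (\<xi> k i \<omega>)\<^sup>2)"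
    proof (intro allI impI)
      fix i assume i: "i < n k"
      have "\<bar>(\<xi> k i \<omega>)\<^sup>2\<bar> \<le> K\<^sup>2" if "\<omega> \<in> space M" for \<omega>
        using power_mono[of "\<bar>\<xi> k i \<omega>\<bar>" K 2] K i that by simp
      moreover have "\<xi> k i \<in> borel_measurable M" using \<xi>M i by simp
      ultimately show "integrable M (\<lambda>\<omega>. (\<xi> k i \<omega>)\<^sup>2)"
        by (intro integrable_const_bound[of _ "K\<^sup>2"]) auto
    qed
    have "0 \<le> \<tau> k 0" using ends(1) assms(1) by simp
    note S = simple_integral_moments[OF this mono \<xi> K, folded S_def]
    note V = nn_integral_simple_value_square[OF mono \<xi>M _ _ \<xi>2, of a t, folded V_def]
    have "S k \<in> borel_measurable M" using S past_measurable by blast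
    moreover have "(\<integral>\<^sup>+p. ennreal ((V k p)\<^sup>2) \<partial>?P) = (\<integral>\<^sup>+\<omega>. ennreal ((S k \<omega>)\<^sup>2) \<partial>M)"
      using S V(2) ends by (simp add: nn_integral_eq_integral)
    ultimately show ?thesis using S V(1) ends by simp
  qed
  then have [measurable]: "\<And>k. S k \<in> borel_measurable M" "\<And>k. V k \<in> borel_measurable ?P" by auto
  have S_fin: "(\<integral>\<^sup>+\<omega>. ennreal ((S k \<omega>)\<^sup>2) \<partial>M) < \<infinity>" for k
    using facts[of k] by (simp add: nn_integral_eq_integral)
  have "(\<lambda>k. \<integral>\<^sup>+p. ennreal ((f' p - V k p)\<^sup>2) \<partial>?P) \<longlonglongrightarrow> 0"
  proof -
    have "(\<integral>\<^sup>+p. ennreal ((f' p - V k p)\<^sup>2) \<partial>?P) = (\<integral>\<^sup>+s\<in>{a..t}. (\<integral>\<^sup>+\<omega>. ennreal ((f s \<omega> -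
        simple_value (n k) (\<tau> k) (\<xi> k) s \<omega>)\<^sup>2) \<partial>M) \<partial>lborel)" for k
    proof -
      have "(\<lambda>p. f' p - V k p) \<in> borel_measurable ?P" by measurable
      from iterated[OF this] show ?thesis by (simp add: f'_def V_def)
    qed
    then show ?thesis using V_lim by simp
  qed
  then have V2: "(\<lambda>k. \<integral>\<^sup>+p. ennreal ((V k p)\<^sup>2) \<partial>?P) \<longlonglongrightarrow> (\<integral>\<^sup>+p. ennreal ((f' p)\<^sup>2) \<partial>?P)"
    using facts S_fin by (intro L2_limit_nn_integral(2)) auto
  note S2 = L2_limit_nn_integral[OF I _ S_fin S_lim[folded S_def]]
  have "(\<integral>\<^sup>+p. ennreal ((f' p)\<^sup>2) \<partial>?P) = (\<integral>\<^sup>+\<omega>. ennreal ((I \<omega>)\<^sup>2) \<partial>M)"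
    using V2 S2(2) facts by (intro LIMSEQ_unique[OF V2]) simp
  moreover show I2: "integrable M (\<lambda>\<omega>. (I \<omega>)\<^sup>2)"
    using S2(1) by (intro integrableI_nonneg) auto
  ultimately show "(\<integral>\<^sup>+s\<in>{a..t}. (\<integral>\<^sup>+\<omega>. ennreal ((f s \<omega>)\<^sup>2) \<partial>M) \<partial>lborel) =
      ennreal (expectation (\<lambda>\<omega>. (I \<omega>)\<^sup>2))"
    using iterated[OF f'] by (simp add: f'_def nn_integral_eq_integral)
  have I1: "integrable M I" using I2 by (rule square_integrable_imp_integrable[rotated]) simp
  \<comment> \<open>As \<open>S k\<close> is centred, \<open>E I = E (I - S k)\<close>, whose square is at most \<open>E ((I - S k)\<^sup>2)\<close>.\<close>
  have "ennreal ((expectation I)\<^sup>2) \<le> (\<integral>\<^sup>+\<omega>. ennreal ((I \<omega> - S k \<omega>)\<^sup>2) \<partial>M)" for k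
  proof -
    have S: "integrable M (S k)" "integrable M (\<lambda>\<omega>. (S k \<omega>)\<^sup>2)" "expectation (S k) = 0"
      using facts[of k] square_integrable_imp_integrable by blast+
    have D2: "integrable M (\<lambda>\<omega>. (I \<omega> - S k \<omega>)\<^sup>2)"
      using I2 S(2) by (intro integrable_square_diff) auto
    have "0 \<le> expectation (\<lambda>\<omega>. (I \<omega> - S k \<omega>)\<^sup>2) - (expectation (\<lambda>\<omega>. I \<omega> - S k \<omega>))\<^sup>2"
      using variance_positive[of "\<lambda>\<omega>. I \<omega> - S k \<omega>"]
        variance_eq[OF Bochner_Integration.integrable_diff[OF I1 S(1)] D2] by linarith
    then show ?thesis using I1 S D2 by (simp add: nn_integral_eq_integral)
  qed
  then have "ennreal ((expectation I)\<^sup>2) \<le> 0"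
    using S_lim[folded S_def] by (intro LIMSEQ_le_const) auto
  then show "expectation I = 0" by simp
qed

end

section \<open>A differential inequality with a power weight\<close>

text \<open>
  Gronwall's argument: the product of \<open>m\<close> with the reciprocal of the solution
  \<open>exp (C (t-a)\<^bsup>p\<^esup> / p)\<close> of the comparison equation is nondecreasing. For \<open>p < 1\<close> the weight
  \<open>(t-a)\<^bsup>p-1\<^esup>\<close> is singular at \<open>a\<close>, so derivatives are taken only for \<open>t > a\<close>, and continuity
  of \<open>m\<close> at \<open>a\<close> brings in the initial value. Applied to \<open>-m\<close>, the lemma yields upper bounds.
\<close>

lemma exponential_minorant:
  fixes m m' :: "real \<Rightarrow> real"
  assumes p: "p > 0" and cont: "continuous_on {a..} m"
    and der: "\<And>t. a < t \<Longrightarrow> (m has_real_derivative m' t) (at t)"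
    and ineq: "\<And>t. a < t \<Longrightarrow> C * (t - a) powr (p - 1) * m t \<le> m' t"
    and "a \<le> t"
  shows "m a * exp (C * (t - a) powr p / p) \<le> m t"
proof -
  define \<phi> where "\<phi> s = m s * exp (- (C * (s - a) powr p / p))" for s
  have "\<phi> a \<le> \<phi> t"
  proof (rule DERIV_nonneg_imp_increasing_open[OF \<open>a \<le> t\<close>])
    fix s assume s: "a < s" "s < t"
    have d: "(\<phi> has_real_derivative (m' s - C * (s - a) powr (p - 1) * m s) * exp (- (C * (s - a) powr p / p))) (at s)"
      unfolding \<phi>_def[abs_def]
      using s p by (auto intro!: derivative_eq_intros der simp: algebra_simps)
    show "\<exists>y. (\<phi> has_real_derivative y) (at s) \<and> y \<ge> 0"
      using d ineq[OF s(1)] by (intro exI conjI) auto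
  next
    show "continuous_on {a..t} \<phi>"
      unfolding \<phi>_def[abs_def] using p
      by (intro continuous_intros continuous_on_subset[OF cont] continuous_on_powr') auto
  qed
  then have "m a * exp (C * (t - a) powr p / p) \<le> \<phi> t * exp (C * (t - a) powr p / p)"
    by (simp add: \<phi>_def)
  also have "\<dots> = m t" by (simp add: \<phi>_def exp_minus)
  finally show ?thesis .
qed

text \<open>
  With \<open>b = ln m0\<close>, the quotient is the growth rate of \<open>m0 * exp (C (t-a)\<^bsup>p\<^esup> / p)\<close>: the initial
  value does not influence the limit.
\<close>

lemma exponential_bound_rate_tendsto:
  fixes a b C p :: real
  assumes "p > 0"
  shows "((\<lambda>t. (b + C * (t - a) powr p / p) / (t - a) powr p) \<longlongrightarrow> C / p) at_top"
proof -
  have "filterlim (\<lambda>t. t - a) at_top at_top"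
    using filterlim_tendsto_add_at_top[OF tendsto_const[of "-a"] filterlim_ident] by simp
  then have "((\<lambda>t. (t - a) powr (- p)) \<longlongrightarrow> 0) at_top"
    using assms by (intro tendsto_neg_powr) auto
  then have "((\<lambda>t. b * (t - a) powr (- p) + C / p) \<longlongrightarrow> b * 0 + C / p) at_top"
    by (intro tendsto_intros)
  moreover have "\<forall>\<^sub>F t in at_top. b * (t - a) powr (- p) + C / p = (b + C * (t - a) powr p / p) / (t - a) powr p"
    using eventually_gt_at_top[of a]
  proof eventually_elim
    case (elim t)
    then have "(t - a) powr p > 0" by simp
    then show ?case by (simp add: powr_minus field_simps)
  qed
  ultimately show ?thesis by (simp add: filterlim_cong[OF refl refl, symmetric])
qed

text \<open>
  The fundamental theorem of calculus for an integrand that may be unbounded at the left end point: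
  split off the integral up to some \<open>b\<close> strictly between \<open>a\<close> and \<open>t\<close>, which is constant.
\<close>

lemma set_integral_has_derivative:
  fixes h :: "real \<Rightarrow> real"
  assumes cont: "continuous_on {a<..} h" and int: "\<And>t. a \<le> t \<Longrightarrow> set_integrable lborel {a..t} h"
    and t: "a < t"
  shows "((\<lambda>r. LINT s:{a..r}|lborel. h s) has_real_derivative h t) (at t)"
proof -
  define b where "b = (a + t) / 2"
  have b: "a < b" "b < t" using t by (auto simp: b_def field_simps)
  have "continuous_on {b..t + 1} h" using b by (intro continuous_on_subset[OF cont]) auto
  then have "((\<lambda>r. integral {b..r} h) has_real_derivative h t) (at t within {b..t + 1})"
    using b by (intro integral_has_real_derivative) auto
  then have "((\<lambda>r. integral {a..b} h + integral {b..r} h) has_real_derivative h t) (at t)"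
    using b by (subst (asm) at_within_interior) (auto intro!: derivative_eq_intros)
  then show ?thesis
  proof (rule has_field_derivative_transform_within_open)
    show "open {b<..<t + 1}" "t \<in> {b<..<t + 1}" using b by auto
  next
    fix r assume "r \<in> {b<..<t + 1}"
    then have r: "a \<le> b" "b \<le> r" "a \<le> r" using b by auto
    show "integral {a..b} h + integral {b..r} h = (LINT s:{a..r}|lborel. h s)"
      using set_borel_integral_eq_integral[OF int[OF r(3)]] r
      by (simp add: Henstock_Kurzweil_Integration.integral_combine)
  qed
qed

section \<open>The second moment of a mild solution\<close>

text \<open>
  A Lipschitz function preserves \<open>L\<^sup>2\<close> continuity, and second moments are continuous for \<open>L\<^sup>2\<close>
  convergence. The lemma serves for \<open>\<phi> = \<sigma>\<close> and for the identity.
\<close>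

lemma L2_continuous_second_moment:
  fixes \<phi> :: "real \<Rightarrow> real"
  assumes u: "L2_continuous M a u"
    and Lip: "\<And>y z. \<bar>\<phi> y - \<phi> z\<bar> \<le> K * \<bar>y - z\<bar>" and \<phi>0: "\<phi> 0 = 0"
  shows "\<And>t. a \<le> t \<Longrightarrow> (\<lambda>\<omega>. \<phi> (u x t \<omega>)) \<in> borel_measurable M"
    and "\<And>t. a \<le> t \<Longrightarrow> integrable M (\<lambda>\<omega>. (\<phi> (u x t \<omega>))\<^sup>2)"
    and "continuous_on {a..} (\<lambda>t. \<integral>\<omega>. (\<phi> (u x t \<omega>))\<^sup>2 \<partial>M)"
proof -
  have K: "0 \<le> K" using Lip[of 1 0] by (simp add: order_trans[OF abs_ge_zero])
  have "K-lipschitz_on UNIV \<phi>"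
    using Lip K by (intro lipschitz_onI) (auto simp: dist_real_def)
  then have "continuous_on UNIV \<phi>" by (rule lipschitz_on_continuous_on)
  then have [measurable]: "\<phi> \<in> borel_measurable borel" by (rule borel_measurable_continuous_onI)
  have um: "u x t \<in> borel_measurable M" and u2: "integrable M (\<lambda>\<omega>. (u x t \<omega>)\<^sup>2)" if "a \<le> t" for t
    using u that by (auto simp: L2_continuous_def)
  have Lip2: "(\<phi> y - \<phi> z)\<^sup>2 \<le> K\<^sup>2 * (y - z)\<^sup>2" for y z
    using power_mono[OF Lip[of y z], of 2] by (simp add: power_mult_distrib)
  show \<phi>m: "(\<lambda>\<omega>. \<phi> (u x t \<omega>)) \<in> borel_measurable M" if "a \<le> t" for t
    using um[OF that] by measurable
  show \<phi>2: "integrable M (\<lambda>\<omega>. (\<phi> (u x t \<omega>))\<^sup>2)" if "a \<le> t" for t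
  proof (rule Bochner_Integration.integrable_bound)
    show "integrable M (\<lambda>\<omega>. K\<^sup>2 * (u x t \<omega>)\<^sup>2)" using u2[OF that] by simp
    show "AE \<omega> in M. norm ((\<phi> (u x t \<omega>))\<^sup>2) \<le> norm (K\<^sup>2 * (u x t \<omega>)\<^sup>2)"
      using Lip2[of _ 0] \<phi>0 by simp
    show "(\<lambda>\<omega>. (\<phi> (u x t \<omega>))\<^sup>2) \<in> borel_measurable M" using \<phi>m[OF that] by measurable
  qed
  show "continuous_on {a..} (\<lambda>t. \<integral>\<omega>. (\<phi> (u x t \<omega>))\<^sup>2 \<partial>M)"
    unfolding continuous_on
  proof
    fix t assume "t \<in> {a..}"
    then have t: "a \<le> t" by simp
    let ?G = "at t within {a..}"
    have ev: "\<forall>\<^sub>F s in ?G. a \<le> s" by (auto simp: eventually_at_filter)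
    have "((\<lambda>(y, s). \<integral>\<omega>. (u y s \<omega> - u x t \<omega>)\<^sup>2 \<partial>M) \<longlongrightarrow> 0) (at (x, t) within UNIV \<times> {a..})"
      using u t by (simp add: L2_continuous_def)
    moreover have "filterlim (\<lambda>s. (x, s)) (at (x, t) within UNIV \<times> {a..}) ?G"
      unfolding filterlim_at by (auto intro!: tendsto_intros simp: eventually_at_filter)
    ultimately have "((\<lambda>s. \<integral>\<omega>. (u x s \<omega> - u x t \<omega>)\<^sup>2 \<partial>M) \<longlongrightarrow> 0) ?G"
      by (auto dest: filterlim_compose)
    then have lim: "((\<lambda>s. K\<^sup>2 * (\<integral>\<omega>. (u x s \<omega> - u x t \<omega>)\<^sup>2 \<partial>M)) \<longlongrightarrow> 0) ?G"
      by (rule tendsto_mult_right_zero)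
    have "\<forall>\<^sub>F s in ?G. (\<integral>\<omega>. (\<phi> (u x s \<omega>) - \<phi> (u x t \<omega>))\<^sup>2 \<partial>M) \<le>
        K\<^sup>2 * (\<integral>\<omega>. (u x s \<omega> - u x t \<omega>)\<^sup>2 \<partial>M)"
      using ev
    proof eventually_elim
      case (elim s)
      have "integrable M (\<lambda>\<omega>. (u x s \<omega> - u x t \<omega>)\<^sup>2)"
        by (intro integrable_square_diff um u2 elim t)
      moreover have "integrable M (\<lambda>\<omega>. (\<phi> (u x s \<omega>) - \<phi> (u x t \<omega>))\<^sup>2)"
        by (intro integrable_square_diff \<phi>m \<phi>2 elim t)
      ultimately show ?case
        using Lip2 by (subst integral_mult_right_zero[symmetric]) (intro integral_mono, auto)
    qed
    then have "((\<lambda>s. \<integral>\<omega>. (\<phi> (u x s \<omega>) - \<phi> (u x t \<omega>))\<^sup>2 \<partial>M) \<longlongrightarrow> 0) ?G"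
      by (intro tendsto_sandwich[OF _ _ tendsto_const lim]) auto
    then show "((\<lambda>s. \<integral>\<omega>. (\<phi> (u x s \<omega>))\<^sup>2 \<partial>M) \<longlongrightarrow> (\<integral>\<omega>. (\<phi> (u x t \<omega>))\<^sup>2 \<partial>M)) ?G"
      using ev \<phi>m \<phi>2 t by (intro L2_norm_tendsto) (auto elim: eventually_mono)
  qed
qed

text \<open>
  Square the mild equation and take expectations: the cross term vanishes because the Ito integral is
  centred, and the isometry evaluates the last one.
\<close>

lemma (in wiener_process) second_moment_mild_solution:
  fixes u :: "real \<Rightarrow> real \<Rightarrow> 'a \<Rightarrow> real" and x :: real
  assumes "0 \<le> a" and \<sigma>: "\<And>y z. \<bar>\<sigma> y - \<sigma> z\<bar> \<le> K * \<bar>y - z\<bar>" "\<sigma> 0 = 0"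
    and mild: "mild_solution M F W a \<alpha> lam \<sigma> u0 u" and L2: "L2_continuous M a u" and t: "a \<le> t"
  defines "h \<equiv> \<lambda>s. (s - a) powr (2 * (\<alpha> - 1)) * expectation (\<lambda>\<omega>. (\<sigma> (u x s \<omega>))\<^sup>2)"
  shows "set_integrable lborel {a..t} h"
    and "expectation (\<lambda>\<omega>. (u x t \<omega>)\<^sup>2) = (u0 x)\<^sup>2 + lam\<^sup>2 * (LINT s:{a..t}|lborel. h s)"
proof -
  note \<sigma>u = L2_continuous_second_moment[OF L2 \<sigma>]
  obtain I where I: "has_ito_integral M F W a t (\<lambda>s \<omega>. (s - a) powr (\<alpha> - 1) * \<sigma> (u x s \<omega>)) I"
    and u: "AE \<omega> in M. u x t \<omega> = u0 x + lam * I \<omega>"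
    using mild t unfolding mild_solution_def by blast
  note iso = ito_isometry[OF \<open>0 \<le> a\<close> I]
  have [measurable]: "I \<in> borel_measurable M" "u x t \<in> borel_measurable M"
    using I L2 t by (auto simp: has_ito_integral_def L2_continuous_def)
  have h_nonneg: "0 \<le> h s" for s by (simp add: h_def)
  have cont: "continuous_on {a<..} h"
    unfolding h_def by (intro continuous_intros continuous_on_subset[OF \<sigma>u(3)]) auto
  have "(\<lambda>s. indicator {a<..t} s *\<^sub>R h s) \<in> borel_measurable borel"
    by (intro borel_measurable_continuous_on_indicator continuous_on_subset[OF cont]) auto
  \<comment> \<open>At \<open>s = a\<close> the weight is \<open>0 powr _ = 0\<close>, so the end point may be added.\<close>
  also have "(\<lambda>s. indicator {a<..t} s *\<^sub>R h s) = (\<lambda>s. indicator {a..t} s *\<^sub>R h s)"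
    by (auto simp: h_def indicator_def fun_eq_iff)
  finally have meas: "(\<lambda>s. indicator {a..t} s *\<^sub>R h s) \<in> borel_measurable lborel" by simp
  have inner: "(\<integral>\<^sup>+\<omega>. ennreal (((s - a) powr (\<alpha> - 1) * \<sigma> (u x s \<omega>))\<^sup>2) \<partial>M) = ennreal (h s)"
    if "a \<le> s" for s
  proof -
    have "((s - a) powr (\<alpha> - 1) * y)\<^sup>2 = (s - a) powr (2 * (\<alpha> - 1)) * y\<^sup>2" for y
      by (simp add: power_mult_distrib power2_eq_square powr_add[symmetric])
    then show ?thesis
      unfolding h_def using \<sigma>u(2)[OF that] by (subst nn_integral_eq_integral) auto
  qed
  have nn: "(\<integral>\<^sup>+s. ennreal (indicator {a..t} s *\<^sub>R h s) \<partial>lborel) = ennreal (expectation (\<lambda>\<omega>. (I \<omega>)\<^sup>2))"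
    unfolding iso(3)[symmetric] using inner
    by (intro nn_integral_cong) (auto simp: indicator_def)
  show int: "set_integrable lborel {a..t} h"
    unfolding set_integrable_def using meas nn h_nonneg by (intro integrableI_nonneg) auto
  have "ennreal (LINT s:{a..t}|lborel. h s) = ennreal (expectation (\<lambda>\<omega>. (I \<omega>)\<^sup>2))"
    unfolding set_lebesgue_integral_def using int h_nonneg nn
    by (subst nn_integral_eq_integral[symmetric]) (auto simp: set_integrable_def)
  then have h_I: "(LINT s:{a..t}|lborel. h s) = expectation (\<lambda>\<omega>. (I \<omega>)\<^sup>2)"
    using h_nonneg by (subst (asm) ennreal_inj) (auto simp: set_lebesgue_integral_def intro!: integral_nonneg)
  have I1: "integrable M I" using iso(1) by (rule square_integrable_imp_integrable[rotated]) simp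
  have "expectation (\<lambda>\<omega>. (u x t \<omega>)\<^sup>2) = expectation (\<lambda>\<omega>. (u0 x + lam * I \<omega>)\<^sup>2)"
    using u by (intro integral_cong_AE) auto
  also have "\<dots> = expectation (\<lambda>\<omega>. (u0 x)\<^sup>2 + 2 * u0 x * lam * I \<omega> + lam\<^sup>2 * (I \<omega>)\<^sup>2)"
    by (simp add: power2_sum power_mult_distrib ac_simps)
  also have "\<dots> = (u0 x)\<^sup>2 + lam\<^sup>2 * expectation (\<lambda>\<omega>. (I \<omega>)\<^sup>2)"
    using iso(1,2) I1 by (simp add: prob_space)
  finally show "expectation (\<lambda>\<omega>. (u x t \<omega>)\<^sup>2) = (u0 x)\<^sup>2 + lam\<^sup>2 * (LINT s:{a..t}|lborel. h s)"
    unfolding h_I .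
qed

text \<open>
  The second moment satisfies \<open>m' = lam\<^sup>2 (t-a)\<^bsup>2(\<alpha>-1)\<^esup> g\<close>, and \<open>L\<^sup>2 m \<le> g \<le> K\<^sup>2 m\<close> turns this into
  a pair of differential inequalities.
\<close>

proposition (in wiener_process) second_moment_bounds:
  fixes u :: "real \<Rightarrow> real \<Rightarrow> 'a \<Rightarrow> real"
  assumes "0 \<le> a" and \<alpha>: "1 / 2 < \<alpha>"
    and \<sigma>: "\<And>y z. \<bar>\<sigma> y - \<sigma> z\<bar> \<le> K * \<bar>y - z\<bar>" "\<sigma> 0 = 0"
    and L: "0 \<le> L" "\<And>y. L * \<bar>y\<bar> \<le> \<bar>\<sigma> y\<bar>"
    and mild: "mild_solution M F W a \<alpha> lam \<sigma> u0 u" and L2: "L2_continuous M a u" and t: "a \<le> t"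
  shows "(u0 x)\<^sup>2 * exp ((lam * L)\<^sup>2 * (t - a) powr (2 * \<alpha> - 1) / (2 * \<alpha> - 1))
      \<le> expectation (\<lambda>\<omega>. (u x t \<omega>)\<^sup>2)"
    and "expectation (\<lambda>\<omega>. (u x t \<omega>)\<^sup>2)
      \<le> (u0 x)\<^sup>2 * exp ((lam * K)\<^sup>2 * (t - a) powr (2 * \<alpha> - 1) / (2 * \<alpha> - 1))"
proof -
  define m where "m t = expectation (\<lambda>\<omega>. (u x t \<omega>)\<^sup>2)" for t
  define g where "g t = expectation (\<lambda>\<omega>. (\<sigma> (u x t \<omega>))\<^sup>2)" for t
  define h where "h t = (t - a) powr (2 * (\<alpha> - 1)) * g t" for t
  note \<sigma>u = L2_continuous_second_moment[OF L2 \<sigma>]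
  note id_u = L2_continuous_second_moment[OF L2, of "\<lambda>y. y" 1, simplified]
  note mh = second_moment_mild_solution[OF \<open>0 \<le> a\<close> \<sigma> mild L2, where x = x, folded g_def h_def m_def]
  have h_cont: "continuous_on {a<..} h"
    unfolding h_def g_def by (intro continuous_intros continuous_on_subset[OF \<sigma>u(3)]) auto
  have m_cont: "continuous_on {a..} m" unfolding m_def using id_u(3) .
  have m_a: "m a = (u0 x)\<^sup>2"
    using mh[of a] set_borel_integral_eq_integral(2)[OF mh(1)[of a]] by simp
  have m_der: "(m has_real_derivative lam\<^sup>2 * h s) (at s)" if s: "a < s" for s
  proof -
    have "((\<lambda>r. (u0 x)\<^sup>2 + lam\<^sup>2 * (LINT s:{a..r}|lborel. h s)) has_real_derivative lam\<^sup>2 * h s) (at s)"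
      using set_integral_has_derivative[OF h_cont mh(1) s] by (auto intro!: derivative_eq_intros)
    then show ?thesis
      by (rule has_field_derivative_transform_within_open[of _ _ _ "{a<..}"]) (use s mh(2) in auto)
  qed
  have L_sq: "L\<^sup>2 * y\<^sup>2 \<le> (\<sigma> y)\<^sup>2" for y
    using power_mono[OF L(2)[of y], of 2] L(1) by (simp add: power_mult_distrib)
  have K_sq: "(\<sigma> y)\<^sup>2 \<le> K\<^sup>2 * y\<^sup>2" for y
    using power_mono[OF \<sigma>(1)[of y 0], of 2] \<sigma>(2) by (simp add: power_mult_distrib)
  have g_lower: "L\<^sup>2 * m s \<le> g s" and g_upper: "g s \<le> K\<^sup>2 * m s" if s: "a \<le> s" for s
  proof -
    note int = \<sigma>u(2)[OF s, of x] id_u(2)[OF s, of x]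
    have "(\<integral>\<omega>. L\<^sup>2 * (u x s \<omega>)\<^sup>2 \<partial>M) \<le> g s"
      unfolding g_def using int L_sq by (intro integral_mono) auto
    then show "L\<^sup>2 * m s \<le> g s" by (simp add: m_def)
    have "g s \<le> (\<integral>\<omega>. K\<^sup>2 * (u x s \<omega>)\<^sup>2 \<partial>M)"
      unfolding g_def using int K_sq by (intro integral_mono) auto
    then show "g s \<le> K\<^sup>2 * m s" by (simp add: m_def)
  qed
  have p: "0 < 2 * \<alpha> - 1" and p1: "2 * \<alpha> - 1 - 1 = 2 * (\<alpha> - 1)" using \<alpha> by auto
  have "m a * exp ((lam * L)\<^sup>2 * (t - a) powr (2 * \<alpha> - 1) / (2 * \<alpha> - 1)) \<le> m t"
  proof (rule exponential_minorant[OF p m_cont m_der _ t])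
    fix s assume "a < s"
    then show "(lam * L)\<^sup>2 * (s - a) powr (2 * \<alpha> - 1 - 1) * m s \<le> lam\<^sup>2 * h s"
      using mult_left_mono[OF g_lower[of s], of "lam\<^sup>2 * (s - a) powr (2 * (\<alpha> - 1))"]
      by (simp add: p1 h_def power_mult_distrib ac_simps)
  qed
  then show "(u0 x)\<^sup>2 * exp ((lam * L)\<^sup>2 * (t - a) powr (2 * \<alpha> - 1) / (2 * \<alpha> - 1))
      \<le> expectation (\<lambda>\<omega>. (u x t \<omega>)\<^sup>2)" by (simp add: m_a m_def[symmetric])
  have "- m a * exp ((lam * K)\<^sup>2 * (t - a) powr (2 * \<alpha> - 1) / (2 * \<alpha> - 1)) \<le> - m t"
  proof (rule exponential_minorant[OF p _ _ _ t])
    show "continuous_on {a..} (\<lambda>s. - m s)" using m_cont by (intro continuous_intros)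
    show "((\<lambda>s. - m s) has_real_derivative - (lam\<^sup>2 * h s)) (at s)" if "a < s" for s
      using m_der[OF that] by (rule DERIV_minus)
    fix s assume "a < s"
    then show "(lam * K)\<^sup>2 * (s - a) powr (2 * \<alpha> - 1 - 1) * - m s \<le> - (lam\<^sup>2 * h s)"
      using mult_left_mono[OF g_upper[of s], of "lam\<^sup>2 * (s - a) powr (2 * (\<alpha> - 1))"]
      by (simp add: p1 h_def power_mult_distrib ac_simps)
  qed
  then show "expectation (\<lambda>\<omega>. (u x t \<omega>)\<^sup>2)
      \<le> (u0 x)\<^sup>2 * exp ((lam * K)\<^sup>2 * (t - a) powr (2 * \<alpha> - 1) / (2 * \<alpha> - 1))"
    by (simp add: m_a m_def[symmetric])
qed

section \<open>The growth rate\<close>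

theorem corollary3p12:
  fixes M :: "'a measure" and F :: "real \<Rightarrow> 'a measure" and W :: "real \<Rightarrow> 'a \<Rightarrow> real"
    and a \<alpha> lam c L\<^sub>\<sigma> Lip\<^sub>\<sigma> :: real
    and u0 \<sigma> :: "real \<Rightarrow> real"
    and u :: "real \<Rightarrow> real \<Rightarrow> 'a \<Rightarrow> real"
  assumes "wiener_process M F W"
    and "a > 0" and "1 / 2 < \<alpha>" and "\<alpha> < 1"
    and "\<And>x. u0 x \<ge> 0" and "bounded (range u0)"
    and "c > 0" and "\<And>x. u0 x > c"
    and "\<sigma> 0 = 0"
    and "L\<^sub>\<sigma> > 0" and "Lip\<^sub>\<sigma> > 0"
    and "\<And>x y. \<bar>\<sigma> x - \<sigma> y\<bar> \<le> Lip\<^sub>\<sigma> * \<bar>x - y\<bar>"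
    and "\<And>x. \<bar>\<sigma> x\<bar> \<ge> L\<^sub>\<sigma> * \<bar>x\<bar>"
    and "lam > 0"
    and "mild_solution M F W a \<alpha> lam \<sigma> u0 u"
    and "L2_continuous M a u"
  shows "\<forall>x.
      ereal ((lam * L\<^sub>\<sigma>)\<^sup>2 / (2 * \<alpha> - 1))
        \<le> Liminf at_top (\<lambda>t. ereal (ln (\<integral>\<omega>. \<bar>u x t \<omega>\<bar>\<^sup>2 \<partial>M) / (t - a) powr (2 * \<alpha> - 1)))
    \<and> Liminf at_top (\<lambda>t. ereal (ln (\<integral>\<omega>. \<bar>u x t \<omega>\<bar>\<^sup>2 \<partial>M) / (t - a) powr (2 * \<alpha> - 1)))
        \<le> Limsup at_top (\<lambda>t. ereal (ln (\<integral>\<omega>. \<bar>u x t \<omega>\<bar>\<^sup>2 \<partial>M) / (t - a) powr (2 * \<alpha> - 1)))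
    \<and> Limsup at_top (\<lambda>t. ereal (ln (\<integral>\<omega>. \<bar>u x t \<omega>\<bar>\<^sup>2 \<partial>M) / (t - a) powr (2 * \<alpha> - 1)))
        \<le> ereal ((lam * Lip\<^sub>\<sigma>)\<^sup>2 / (2 * \<alpha> - 1))
    \<and> (\<forall>L. Lip\<^sub>\<sigma> = L \<and> L\<^sub>\<sigma> = L \<longrightarrow>
        ((\<lambda>t. ln (\<integral>\<omega>. \<bar>u x t \<omega>\<bar>\<^sup>2 \<partial>M) / (t - a) powr (2 * \<alpha> - 1))
          \<longlongrightarrow> (lam * L)\<^sup>2 / (2 * \<alpha> - 1)) at_top)"
proof
  fix x
  define p where "p = 2 * \<alpha> - 1"
  define r where "r t = ln (\<integral>\<omega>. \<bar>u x t \<omega>\<bar>\<^sup>2 \<partial>M) / (t - a) powr p" for t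
  define b where "b C t = (ln ((u0 x)\<^sup>2) + C * (t - a) powr p / p) / (t - a) powr p" for C t
  have p: "p > 0" using assms(3) by (simp add: p_def)
  have u0: "(u0 x)\<^sup>2 > 0" using assms(7) assms(8)[of x] by simp
  have b_lim: "(b C \<longlongrightarrow> C / p) at_top" for C
    unfolding b_def[abs_def] using p by (rule exponential_bound_rate_tendsto)
  have bounds: "\<forall>\<^sub>F t in at_top. b ((lam * L\<^sub>\<sigma>)\<^sup>2) t \<le> r t \<and> r t \<le> b ((lam * Lip\<^sub>\<sigma>)\<^sup>2) t"
    using eventually_gt_at_top[of a]
  proof eventually_elim
    case (elim t)
    let ?m = "\<integral>\<omega>. (u x t \<omega>)\<^sup>2 \<partial>M"
    have ln_exp: "ln ((u0 x)\<^sup>2 * exp y) = ln ((u0 x)\<^sup>2) + y" for y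
      using u0 by (subst ln_mult) auto
    have t: "0 \<le> a" "0 \<le> L\<^sub>\<sigma>" "a \<le> t" using assms(2,10) elim by auto
    note sandwich = wiener_process.second_moment_bounds[OF assms(1) t(1) assms(3,12,9) t(2)
        assms(13,15,16) t(3), of x, folded p_def]
    have lo: "(u0 x)\<^sup>2 * exp ((lam * L\<^sub>\<sigma>)\<^sup>2 * (t - a) powr p / p) \<le> ?m"
      and up: "?m \<le> (u0 x)\<^sup>2 * exp ((lam * Lip\<^sub>\<sigma>)\<^sup>2 * (t - a) powr p / p)"
      using sandwich .
    have "0 < (u0 x)\<^sup>2 * exp ((lam * L\<^sub>\<sigma>)\<^sup>2 * (t - a) powr p / p)" using u0 by simp
    then have "ln ((u0 x)\<^sup>2) + (lam * L\<^sub>\<sigma>)\<^sup>2 * (t - a) powr p / p \<le> ln ?m \<and>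
        ln ?m \<le> ln ((u0 x)\<^sup>2) + (lam * Lip\<^sub>\<sigma>)\<^sup>2 * (t - a) powr p / p"
      unfolding ln_exp[symmetric] using lo up by (auto intro!: ln_mono)
    then show ?case unfolding b_def r_def by (simp add: divide_right_mono)
  qed
  have "ereal ((lam * L\<^sub>\<sigma>)\<^sup>2 / p) \<le> Liminf at_top (\<lambda>t. ereal (r t))"
  proof -
    have lim: "Liminf at_top (\<lambda>t. ereal (b ((lam * L\<^sub>\<sigma>)\<^sup>2) t)) = ereal ((lam * L\<^sub>\<sigma>)\<^sup>2 / p)"
      using b_lim by (intro lim_imp_Liminf) auto
    have "\<forall>\<^sub>F t in at_top. ereal (b ((lam * L\<^sub>\<sigma>)\<^sup>2) t) \<le> ereal (r t)"
      using bounds by eventually_elim simp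
    from Liminf_mono[OF this] show ?thesis using lim by simp
  qed
  moreover have "Limsup at_top (\<lambda>t. ereal (r t)) \<le> ereal ((lam * Lip\<^sub>\<sigma>)\<^sup>2 / p)"
  proof -
    have lim: "Limsup at_top (\<lambda>t. ereal (b ((lam * Lip\<^sub>\<sigma>)\<^sup>2) t)) = ereal ((lam * Lip\<^sub>\<sigma>)\<^sup>2 / p)"
      using b_lim by (intro lim_imp_Limsup) auto
    have "\<forall>\<^sub>F t in at_top. ereal (r t) \<le> ereal (b ((lam * Lip\<^sub>\<sigma>)\<^sup>2) t)"
      using bounds by eventually_elim simp
    from Limsup_mono[OF this] show ?thesis using lim by simp
  qed
  moreover have "Liminf at_top (\<lambda>t. ereal (r t)) \<le> Limsup at_top (\<lambda>t. ereal (r t))"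
    by (intro Liminf_le_Limsup) simp
  moreover have "(r \<longlongrightarrow> (lam * L)\<^sup>2 / p) at_top" if "Lip\<^sub>\<sigma> = L" "L\<^sub>\<sigma> = L" for L
    using bounds that b_lim[of "(lam * L)\<^sup>2"]
    by (intro tendsto_sandwich[of "b ((lam * L)\<^sup>2)" r _ "b ((lam * L)\<^sup>2)"]) (auto elim: eventually_mono)
  ultimately show "ereal ((lam * L\<^sub>\<sigma>)\<^sup>2 / (2 * \<alpha> - 1))
        \<le> Liminf at_top (\<lambda>t. ereal (ln (\<integral>\<omega>. \<bar>u x t \<omega>\<bar>\<^sup>2 \<partial>M) / (t - a) powr (2 * \<alpha> - 1)))
    \<and> Liminf at_top (\<lambda>t. ereal (ln (\<integral>\<omega>. \<bar>u x t \<omega>\<bar>\<^sup>2 \<partial>M) / (t - a) powr (2 * \<alpha> - 1)))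
        \<le> Limsup at_top (\<lambda>t. ereal (ln (\<integral>\<omega>. \<bar>u x t \<omega>\<bar>\<^sup>2 \<partial>M) / (t - a) powr (2 * \<alpha> - 1)))
    \<and> Limsup at_top (\<lambda>t. ereal (ln (\<integral>\<omega>. \<bar>u x t \<omega>\<bar>\<^sup>2 \<partial>M) / (t - a) powr (2 * \<alpha> - 1)))
        \<le> ereal ((lam * Lip\<^sub>\<sigma>)\<^sup>2 / (2 * \<alpha> - 1))
    \<and> (\<forall>L. Lip\<^sub>\<sigma> = L \<and> L\<^sub>\<sigma> = L \<longrightarrow>
        ((\<lambda>t. ln (\<integral>\<omega>. \<bar>u x t \<omega>\<bar>\<^sup>2 \<partial>M) / (t - a) powr (2 * \<alpha> - 1))
          \<longlongrightarrow> (lam * L)\<^sup>2 / (2 * \<alpha> - 1)) at_top)"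
    unfolding r_def p_def by blast
qed

end
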